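(* Let $\mathcal{I}$ be an ideal on $\mathbf{N}$ such that $\mathcal{I}\subseteq\mathcal{Z}$, where $\mathcal{Z}=\{A\subseteq\mathbf{N}:\lim_{n\to\infty}|A\cap[1,n]|/n=0\}$. Then $\mathcal{I}$-statistical convergence coincides with statistical convergence.
   Context: $\mathbf{N}$ denotes the positive integers. An ideal on $\mathbf{N}$ is a family $\mathcal{I}\subseteq\mathcal{P}(\mathbf{N})$ closed under finite unions and subsets, containing all finite subsets of $\mathbf{N}$, and different from $\mathcal{P}(\mathbf{N})$. A sequence $(x_n)$ in a Hausdorff space $X$ is statistically convergent to $\ell\in X$ if $\{n\in\mathbf{N}:x_n\notin U\}\in\mathcal{Z}$ for all neighborhoods $U$ of $\ell$. It is $\mathcal{I}$-statistically convergent to $\ell$ if $$\left\{n\in\mathbf{N}:\frac{|\{k\in[1,n]:x_k\notin U\}|}{n}\ge\varepsilon\right\}\in\mathcal{I}$$ for all neighborhoods $U$ of $\ell$ and all $\varepsilon>0$. The two notions coincide if, for some Hausdorff space $X$ with at least two points, every sequence $(x_n)$ in $X$ is $\mathcal{I}$-statistically convergent to $\ell\in X$ if and only if it is statistically convergent to $\ell$. *)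

theory Defs
  imports "HOL-Analysis.T1_Spaces"
begin

text \<open>The positive integers are the subset \<open>{1..}\<close> of \<^typ>\<open>nat\<close>. A sequence indexed by them
  is a function on \<^typ>\<open>nat\<close> whose value at \<open>0\<close> is ignored.\<close>

definition ideal_on_pos :: "nat set set \<Rightarrow> bool" where
  "ideal_on_pos I \<longleftrightarrow>
     I \<subseteq> Pow {1..} \<and>
     (\<forall>A\<in>I. \<forall>B\<in>I. A \<union> B \<in> I) \<and>
     (\<forall>A\<in>I. \<forall>B. B \<subseteq> A \<longrightarrow> B \<in> I) \<and>
     (\<forall>A. finite A \<and> A \<subseteq> {1..} \<longrightarrow> A \<in> I) \<and>
     I \<noteq> Pow {1..}"

definition density_zero :: "nat set set" where
  "density_zero =
     {A. A \<subseteq> {1..} \<and> (\<lambda>n. real (card (A \<inter> {1..n})) / real n) \<longlonglongrightarrow> 0}"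

definition neighborhood_in :: "'a topology \<Rightarrow> 'a \<Rightarrow> 'a set \<Rightarrow> bool" where
  "neighborhood_in X l U \<longleftrightarrow> U \<subseteq> topspace X \<and> (\<exists>V. openin X V \<and> l \<in> V \<and> V \<subseteq> U)"

definition stat_convergent :: "'a topology \<Rightarrow> (nat \<Rightarrow> 'a) \<Rightarrow> 'a \<Rightarrow> bool" where
  "stat_convergent X x l \<longleftrightarrow>
     (\<forall>U. neighborhood_in X l U \<longrightarrow> {n \<in> {1..}. x n \<notin> U} \<in> density_zero)"

definition ideal_stat_convergent ::
    "nat set set \<Rightarrow> 'a topology \<Rightarrow> (nat \<Rightarrow> 'a) \<Rightarrow> 'a \<Rightarrow> bool" where
  "ideal_stat_convergent I X x l \<longleftrightarrow>
     (\<forall>U. neighborhood_in X l U \<longrightarrow>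
       (\<forall>\<epsilon>::real. \<epsilon> > 0 \<longrightarrow>
         {n \<in> {1..}. real (card {k \<in> {1..n}. x k \<notin> U}) / real n \<ge> \<epsilon>} \<in> I))"

text \<open>HOL cannot quantify over all types inside a formula, so the existential quantifier over
  Hausdorff spaces ranges over the spaces whose points are elements of a given type \<open>'a\<close>; the
  underlying set \<^term>\<open>topspace X\<close> may be any subset of it.\<close>

definition ideal_stat_coincides_with_stat :: "'a itself \<Rightarrow> nat set set \<Rightarrow> bool" where
  "ideal_stat_coincides_with_stat _ I \<longleftrightarrow>
     (\<exists>X :: 'a topology.
        Hausdorff_space X \<and>
        (\<exists>a\<in>topspace X. \<exists>b\<in>topspace X. a \<noteq> b) \<and>
        (\<forall>x. (\<forall>n\<in>{1..}. x n \<in> topspace X) \<longrightarrow>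
          (\<forall>l\<in>topspace X. ideal_stat_convergent I X x l \<longleftrightarrow> stat_convergent X x l)))"

end

theory Submission imports Defs begin

text \<open>
  Write \<open>d A n = |A \<inter> [1,n]| / n\<close>. If \<open>d A n \<ge> \<epsilon>\<close>, then \<open>d A m \<ge> \<epsilon> / 2\<close> for every
  \<open>m \<in> [n, 2n]\<close>, so the set \<open>B = {m. d A m \<ge> \<epsilon> / 2}\<close> satisfies \<open>d B (2n) \<ge> 1 / 2\<close>. If \<open>B\<close>
  has density zero, this is possible for only finitely many \<open>n\<close>. Conversely, if \<open>A\<close> has density
  zero, all these sets \<open>B\<close> are finite and so belong to every ideal.
\<close>

definition initial_density :: "nat set \<Rightarrow> nat \<Rightarrow> real" where
  "initial_density A n = real (card (A \<inter> {1..n})) / real n"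

lemma initial_density_nonneg: "0 \<le> initial_density A n"
  by (simp add: initial_density_def)

lemma density_zero_iff:
  "A \<in> density_zero \<longleftrightarrow> A \<subseteq> {1..} \<and> initial_density A \<longlonglongrightarrow> 0"
  by (simp add: density_zero_def initial_density_def[abs_def])

text \<open>Passing from \<open>n\<close> to \<open>m\<close> can only increase the count of
  elements of \<open>A\<close>, while the denominator at most doubles.\<close>

lemma initial_density_double:
  assumes "n \<ge> 1" "initial_density A n \<ge> \<epsilon>" "\<epsilon> > 0" "n \<le> m" "m \<le> 2 * n"
  shows "initial_density A m \<ge> \<epsilon> / 2"
proof -
  have "card (A \<inter> {1..n}) \<le> card (A \<inter> {1..m})"
    using assms by (intro card_mono) auto
  moreover have "\<epsilon> * real n \<le> real (card (A \<inter> {1..n}))"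
    using assms by (simp add: initial_density_def field_simps)
  moreover have "\<epsilon> * real m \<le> \<epsilon> * (2 * real n)"
    using assms by (intro mult_left_mono) auto
  ultimately have "\<epsilon> * real m \<le> 2 * real (card (A \<inter> {1..m}))"
    by linarith
  then show ?thesis
    using assms by (simp add: initial_density_def field_simps)
qed

lemma density_zero_if_superlevel_sets_density_zero:
  assumes "A \<subseteq> {1..}"
    and superlevel: "\<And>\<epsilon>. \<epsilon> > 0 \<Longrightarrow> {n \<in> {1..}. initial_density A n \<ge> \<epsilon>} \<in> density_zero"
  shows "A \<in> density_zero"
proof -
  have "\<exists>N. \<forall>n\<ge>N. norm (initial_density A n - 0) < \<epsilon>" if "\<epsilon> > 0" for \<epsilon>
  proof -
    define B where "B = {n \<in> {1..}. initial_density A n \<ge> \<epsilon> / 2}"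
    have "initial_density B \<longlonglongrightarrow> 0"
      using superlevel[of "\<epsilon> / 2"] \<open>\<epsilon> > 0\<close> by (simp add: B_def density_zero_iff)
    then have "eventually (\<lambda>n. initial_density B n < 1 / 2) sequentially"
      by (rule order_tendstoD(2)) simp
    then obtain N where N: "\<And>n. n \<ge> N \<Longrightarrow> initial_density B n < 1 / 2"
      by (auto simp: eventually_sequentially)
    \<comment> \<open>The bound \<open>1\<close> keeps \<open>n\<close> positive, which the doubling
      estimate and the division by \<open>2 * n\<close> require. The bound \<open>N\<close> is
      applied at \<open>2 * n\<close>.\<close>
    have "initial_density A n < \<epsilon>" if n: "n \<ge> max N 1" for n
    proof (rule ccontr)
      assume "\<not> ?thesis"
      then have "{n..2 * n} \<subseteq> B \<inter> {1..2 * n}"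
        using initial_density_double[of n \<epsilon> A] n \<open>\<epsilon> > 0\<close> by (auto simp: B_def)
      then have "card {n..2 * n} \<le> card (B \<inter> {1..2 * n})"
        by (intro card_mono) auto
      \<comment> \<open>The interval has \<open>n + 1\<close> elements, more than half of
        \<open>2 * n\<close>.\<close>
      then have "initial_density B (2 * n) \<ge> 1 / 2"
        using n by (simp add: initial_density_def field_simps)
      then show False
        using N[of "2 * n"] n by simp
    qed
    then show ?thesis
      using initial_density_nonneg by (intro exI[of _ "max N 1"]) auto
  qed
  then show ?thesis
    using assms(1) by (auto simp: density_zero_iff intro: LIMSEQ_I)
qed

lemma finite_superlevel_set_if_density_zero:
  assumes "A \<in> density_zero" "\<epsilon> > 0"
  shows "finite {n \<in> {1..}. initial_density A n \<ge> \<epsilon>}"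
proof -
  have "eventually (\<lambda>n. initial_density A n < \<epsilon>) sequentially"
    using assms by (intro order_tendstoD(2)[where y = 0]) (auto simp: density_zero_iff)
  then obtain N where "\<And>n. n \<ge> N \<Longrightarrow> initial_density A n < \<epsilon>"
    by (auto simp: eventually_sequentially)
  then have "n < N" if "initial_density A n \<ge> \<epsilon>" for n
    using that by (meson linorder_not_le)
  then have "{n \<in> {1..}. initial_density A n \<ge> \<epsilon>} \<subseteq> {..<N}"
    by blast
  then show ?thesis
    using finite_subset by blast
qed

text \<open>The forward direction uses the inclusion of \<open>I\<close> in
  \<open>density_zero\<close>; the backward one uses that \<open>I\<close> contains the finite sets
  of positive integers.\<close>

lemma superlevel_sets_in_ideal_iff_density_zero:
  assumes "ideal_on_pos I" "I \<subseteq> density_zero" "A \<subseteq> {1..}"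
  shows "(\<forall>\<epsilon>>0. {n \<in> {1..}. initial_density A n \<ge> \<epsilon>} \<in> I) \<longleftrightarrow> A \<in> density_zero"
proof
  assume "\<forall>\<epsilon>>0. {n \<in> {1..}. initial_density A n \<ge> \<epsilon>} \<in> I"
  then have "{n \<in> {1..}. initial_density A n \<ge> \<epsilon>} \<in> density_zero" if "\<epsilon> > 0" for \<epsilon>
    using assms(2) that by blast
  then show "A \<in> density_zero"
    by (rule density_zero_if_superlevel_sets_density_zero[OF assms(3)])
next
  assume A: "A \<in> density_zero"
  have finite_in_ideal: "S \<in> I" if "finite S" "S \<subseteq> {1..}" for S
    using assms(1) that unfolding ideal_on_pos_def by blast
  show "\<forall>\<epsilon>>0. {n \<in> {1..}. initial_density A n \<ge> \<epsilon>} \<in> I"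
    by (intro allI impI finite_in_ideal finite_superlevel_set_if_density_zero[OF A]) blast+
qed

text \<open>Both notions range over the same neighborhoods, so it suffices to compare their
  conditions for a single \<open>U\<close>, taking as \<open>A\<close> the set of positive indices
  whose terms lie outside \<open>U\<close>.\<close>

lemma ideal_stat_convergent_iff_stat_convergent:
  assumes "ideal_on_pos I" "I \<subseteq> density_zero"
  shows "ideal_stat_convergent I X x l \<longleftrightarrow> stat_convergent X x l"
proof -
  have "real (card {k \<in> {1..n}. x k \<notin> U}) / real n = initial_density {k \<in> {1..}. x k \<notin> U} n"
    for U n
  proof -
    have "{k \<in> {1..n}. x k \<notin> U} = {k \<in> {1..}. x k \<notin> U} \<inter> {1..n}"
      by auto
    then show ?thesis
      by (simp only: initial_density_def)
  qed
  moreover have "(\<forall>\<epsilon>>0. {n \<in> {1..}. initial_density {k \<in> {1..}. x k \<notin> U} n \<ge> \<epsilon>} \<in> I)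
      \<longleftrightarrow> {k \<in> {1..}. x k \<notin> U} \<in> density_zero" for U
    using assms by (intro superlevel_sets_in_ideal_iff_density_zero) auto
  ultimately show ?thesis
    by (simp only: ideal_stat_convergent_def stat_convergent_def)
qed

theorem corollary2p8:
  fixes I :: "nat set set"
  assumes "ideal_on_pos I"
    and "I \<subseteq> density_zero"
    and "\<exists>a b :: 'a. a \<noteq> b"
  shows "ideal_stat_coincides_with_stat TYPE('a) I"
  unfolding ideal_stat_coincides_with_stat_def
  using assms(3)
  \<comment> \<open>The equivalence holds in every topological space, so any Hausdorff space with
    two points is a witness; the discrete one exists on every type with two distinct
    elements.\<close>
  by (intro exI[of _ "discrete_topology (UNIV :: 'a set)"])
    (simp add: ideal_stat_convergent_iff_stat_convergent[OF assms(1,2)])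

end
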